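(* Let $Q_0=Q_0(\cdot\mid K_{t-1},g_t)$ be the base stage trajectory distribution at a fixed prefix $K_{t-1}$ and sub-goal $g_t$, let $W=W_{t,\lambda_t}(K_{t-1},g_t,\cdot)\ge 0$ be a measurable retention weight with $0<\mathbb E_{Q_0}[W]<\infty$, let $Q_{\lambda_t}$ be the guidance-filtered distribution with $dQ_{\lambda_t}/dQ_0=W/\mathbb E_{Q_0}[W]$, and let $\mathcal R=\mathcal R_t^{\mathrm{stg}}(K_{t-1})$ be the set of recoverable stage trajectories. Assume $0<Q_0(\mathcal R)<1$ and that the average retention weights $\bar W_{t,R_t^{\mathrm{stg}}}:=\mathbb E_{Q_0(\cdot\mid\mathcal R)}[W]$ and $\bar W_{t,R^c}:=\mathbb E_{Q_0(\cdot\mid\mathcal R^c)}[W]$ both lie in $(0,\infty)$. Define $$\omega_t^0(K_{t-1}):=\log\frac{Q_0(\mathcal R)}{Q_0(\mathcal R^c)},\qquad \Gamma_{t,\lambda_t}(K_{t-1}):=\log\bar W_{t,R_t^{\mathrm{stg}}}-\log\bar W_{t,R^c},\qquad \sigma(u):=\frac{1}{1+e^{-u}}.$$ Then guidance improves stage recoverability relative to the unguided base distribution at the same prefix, i.e. $Q_{\lambda_t}(\mathcal R)>Q_0(\mathcal R)$, if and only if $\Gamma_{t,\lambda_t}(K_{t-1})>0$; and it harms stage recoverability, i.e. $Q_{\lambda_t}(\mathcal R)<Q_0(\mathcal R)$, if and only if $\Gamma_{t,\lambda_t}(K_{t-1})<0$. Moreover, for $\gamma\ge 0$: if $\Gamma_{t,\lambda_t}(K_{t-1})\ge\gamma$,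 then $$Q_{\lambda_t}(\mathcal R)\ge\sigma\left(\omega_t^0(K_{t-1})+\gamma\right),$$ and if $\Gamma_{t,\lambda_t}(K_{t-1})\le-\gamma$, then $$Q_{\lambda_t}(\mathcal R)\le\sigma\left(\omega_t^0(K_{t-1})-\gamma\right).$$
   Context: At stage $t$ of a harnessed agent execution, $K_{t-1}$ is the fixed completed prefix (task, earlier sub-goals and earlier stage trajectories) and $g_t$ the current sub-goal. $Q_0(\cdot\mid K_{t-1},g_t)$ is a probability measure on the measurable space of stage trajectories $\tau_t$, describing the unguided agent. $\lambda_t$ is the guidance amount; guidance enters only through the weight $W_{t,\lambda_t}(K_{t-1},g_t,\tau_t)$. The set $\mathcal R_t^{\mathrm{stg}}(K_{t-1})$ consists of those $\tau_t$ such that the extended prefix $K_t=(K_{t-1},g_t,\tau_t)$ remains recoverable (some continuation reaches the correct final answer); it is measurable, and it plays the role of an arbitrary measurable event here. All probabilities $Q_0(\cdot)$, $Q_{\lambda_t}(\cdot)$ in the claim are conditional on $(K_{t-1},g_t)$. *)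

theory Defs
  imports "HOL-Probability.Probability"
begin

text \<open>
  The prefix, the sub-goal, the stage and the guidance amount are fixed throughout and are left
  implicit: \<open>Q\<close> is the base distribution of stage trajectories given them, \<open>W\<close> the retention
  weight as a function of the trajectory, and \<open>R\<close> the event that the extended prefix is
  recoverable. Complements of events are taken in \<open>space Q\<close>.
\<close>

definition guided :: "'a measure \<Rightarrow> ('a \<Rightarrow> real) \<Rightarrow> 'a measure" where
  "guided Q W = density Q (\<lambda>\<tau>. ennreal (W \<tau> / (\<integral>x. W x \<partial>Q)))"

text \<open>For an event \<open>A\<close> of positive probability, \<open>uniform_measure Q A\<close> is the conditional
  distribution of \<open>Q\<close> given \<open>A\<close>.\<close>

definition avg_weight :: "'a measure \<Rightarrow> ('a \<Rightarrow> real) \<Rightarrow> 'a set \<Rightarrow> real" where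
  "avg_weight Q W A = (\<integral>\<tau>. W \<tau> \<partial>uniform_measure Q A)"

definition base_log_odds :: "'a measure \<Rightarrow> 'a set \<Rightarrow> real" where
  "base_log_odds Q R = ln (measure Q R / measure Q (space Q - R))"

definition guidance_gain :: "'a measure \<Rightarrow> ('a \<Rightarrow> real) \<Rightarrow> 'a set \<Rightarrow> real" where
  "guidance_gain Q W R = ln (avg_weight Q W R) - ln (avg_weight Q W (space Q - R))"

definition sigmoid :: "real \<Rightarrow> real" where
  "sigmoid u = 1 / (1 + exp (- u))"

end

(* By Bayes' rule, reweighting by W multiplies the odds of R by the ratio of the average weights on R
   and on its complement. Hence the guided log odds of R exceed the base log odds by exactly the
   guidance gain, and every claim is monotonicity of the sigmoid. *)
theory Submission
  imports Defs
begin

lemma sigmoid_less_iff [simp]: "sigmoid u < sigmoid v \<longleftrightarrow> u < v"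
proof -
  have "0 < 1 + exp (- u)" "0 < 1 + exp (- v)"
    by (simp_all add: add_pos_pos)
  then show ?thesis
    by (simp add: sigmoid_def divide_simps)
qed

lemma sigmoid_le_iff [simp]: "sigmoid u \<le> sigmoid v \<longleftrightarrow> u \<le> v"
  using sigmoid_less_iff[of v u] by linarith

text \<open>The sigmoid inverts the log odds. The masses \<open>a\<close> and \<open>b\<close> are
  not assumed to sum to 1, so this serves both the base probabilities and the weighted masses of an
  event and its complement.\<close>

lemma sigmoid_ln_div:
  assumes "0 < a" "0 < b"
  shows "sigmoid (ln (a / b)) = a / (a + b)"
proof -
  have exp_eq: "exp (- ln (a / b)) = b / a"
    using assms by (simp add: exp_minus)
  show ?thesis
    unfolding sigmoid_def exp_eq using assms by (simp add: field_simps)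
qed

lemma (in finite_measure) avg_weight_eq:
  assumes "A \<in> sets M" "0 < measure M A" "W \<in> borel_measurable M"
  shows "avg_weight M W A = (\<integral>x\<in>A. W x \<partial>M) / measure M A"
proof -
  \<comment> \<open>Conditioning is defined by a quotient in \<open>ennreal\<close>; positivity of
    \<open>measure M A\<close> turns it into a real density, the form in which a Bochner integral
    can be transferred to \<open>M\<close>.\<close>
  have "uniform_measure M A = density M (\<lambda>x. ennreal (indicator A x / measure M A))"
    unfolding uniform_measure_def using assms(2)
    by (intro arg_cong[where f = "density M"] ext)
      (simp add: emeasure_eq_measure divide_ennreal flip: ennreal_indicator)
  then have "avg_weight M W A = (\<integral>x. (indicator A x / measure M A) *\<^sub>R W x \<partial>M)"
    using assms by (simp add: avg_weight_def integral_density)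
  then show ?thesis
    by (simp add: set_lebesgue_integral_def)
qed

text \<open>A density assigns \<open>A\<close> a nonnegative integral in \<open>ennreal\<close>;
  since \<open>W\<close> is integrable and nonnegative, this is a real integral, and the constant
  normaliser factors out. If the normaliser is 0, both sides are 0 because division by zero yields
  0.\<close>

lemma measure_guided:
  assumes "W \<in> borel_measurable M" "\<And>x. x \<in> space M \<Longrightarrow> 0 \<le> W x" "integrable M W"
    and "A \<in> sets M"
  shows "measure (guided M W) A = (\<integral>x\<in>A. W x \<partial>M) / (\<integral>x. W x \<partial>M)"
proof -
  let ?E = "\<integral>x. W x \<partial>M"
  have E: "0 \<le> ?E"
    using assms(2) by (intro integral_nonneg_AE) auto
  have int: "integrable M (\<lambda>x. indicator A x * W x / ?E)"
    using integrable_mult_indicator[OF assms(4,3)] by auto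
  have "emeasure (guided M W) A = (\<integral>\<^sup>+x. ennreal (W x / ?E) * indicator A x \<partial>M)"
    using assms by (simp add: guided_def emeasure_density)
  also have "\<dots> = (\<integral>\<^sup>+x. ennreal (indicator A x * W x / ?E) \<partial>M)"
    by (intro nn_integral_cong) (simp add: indicator_def)
  also have "\<dots> = ennreal (\<integral>x. indicator A x * W x / ?E \<partial>M)"
    using assms E by (intro nn_integral_eq_integral[OF int]) auto
  also have "(\<integral>x. indicator A x * W x / ?E \<partial>M) = (\<integral>x\<in>A. W x \<partial>M) / ?E"
    by (simp add: set_lebesgue_integral_def)
  finally have "emeasure (guided M W) A = ennreal ((\<integral>x\<in>A. W x \<partial>M) / ?E)" .
  \<comment> \<open>Passing from \<open>emeasure\<close> to \<open>measure\<close> inverts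
    \<open>ennreal\<close>, which is faithful only on nonnegative reals.\<close>
  moreover have "0 \<le> (\<integral>x\<in>A. W x \<partial>M)"
    unfolding set_lebesgue_integral_def
    using assms(2) by (intro integral_nonneg_AE) auto
  ultimately show ?thesis
    using E by (simp add: measure_def)
qed

context
  fixes Q :: "'a measure" and R :: "'a set"
  assumes Q: "prob_space Q" and R: "R \<in> sets Q"
    and pos: "0 < measure Q R" and less_1: "measure Q R < 1"
begin

interpretation prob_space Q by (rule Q)

text \<open>Here the two masses do sum to 1, so the fraction given by \<open>sigmoid_ln_div\<close>
  is the probability itself.\<close>

lemma base_prob_eq_sigmoid: "measure Q R = sigmoid (base_log_odds Q R)"
  using pos less_1 R
  by (simp add: base_log_odds_def prob_compl sigmoid_ln_div)

lemma guided_prob_eq_sigmoid: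
  assumes W: "W \<in> borel_measurable Q" "\<And>\<tau>. \<tau> \<in> space Q \<Longrightarrow> 0 \<le> W \<tau>" "integrable Q W"
    and avg: "0 < avg_weight Q W R" "0 < avg_weight Q W (space Q - R)"
  shows "measure (guided Q W) R = sigmoid (base_log_odds Q R + guidance_gain Q W R)"
proof -
  let ?p = "measure Q R" and ?q = "measure Q (space Q - R)"
  let ?a = "avg_weight Q W R" and ?b = "avg_weight Q W (space Q - R)"
  have q: "0 < ?q"
    using less_1 R by (simp add: prob_compl)
  have on_R: "(\<integral>x\<in>R. W x \<partial>Q) = ?p * ?a"
    using avg_weight_eq[OF R pos W(1)] pos by simp
  have on_compl: "(\<integral>x\<in>space Q - R. W x \<partial>Q) = ?q * ?b"
    using avg_weight_eq[OF _ q W(1)] R q by simp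
  \<comment> \<open>Total expectation: splitting the normaliser over \<open>R\<close> and its
    complement gives the guided probability the shape \<open>x / (x + y)\<close>.\<close>
  have "(\<integral>x. W x \<partial>Q) = (\<integral>x\<in>R \<union> (space Q - R). W x \<partial>Q)"
    using sets.sets_into_space[OF R] W(3) by (simp add: Un_absorb1 set_integral_space)
  also have "\<dots> = ?p * ?a + ?q * ?b"
    unfolding on_R[symmetric] on_compl[symmetric] using R W(3)
    by (intro set_integral_Un)
      (auto simp: set_integrable_def simp del: real_scaleR_def intro!: integrable_mult_indicator)
  finally have "measure (guided Q W) R = ?p * ?a / (?p * ?a + ?q * ?b)"
    using measure_guided[OF W R] on_R by simp
  also have "\<dots> = sigmoid (ln ((?p * ?a) / (?q * ?b)))"
    using pos q avg by (simp add: sigmoid_ln_div)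
  \<comment> \<open>The odds factor as \<open>(?p / ?q) * (?a / ?b)\<close>; all four factors are
    positive, so the logarithm separates the base odds from the gain.\<close>
  also have "ln ((?p * ?a) / (?q * ?b)) = base_log_odds Q R + guidance_gain Q W R"
    using pos q avg by (simp add: base_log_odds_def guidance_gain_def ln_div ln_mult)
  finally show ?thesis .
qed

end

theorem theorem8:
  fixes Q0 :: "'a measure" and W :: "'a \<Rightarrow> real" and R :: "'a set"
  assumes "prob_space Q0"
    and "W \<in> borel_measurable Q0"
    and "\<And>\<tau>. \<tau> \<in> space Q0 \<Longrightarrow> 0 \<le> W \<tau>"
    and "integrable Q0 W"
    and "0 < (\<integral>\<tau>. W \<tau> \<partial>Q0)"
    and "R \<in> sets Q0"
    and "0 < measure Q0 R"
    and "measure Q0 R < 1"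
    and "integrable (uniform_measure Q0 R) W"
    and "0 < avg_weight Q0 W R"
    and "integrable (uniform_measure Q0 (space Q0 - R)) W"
    and "0 < avg_weight Q0 W (space Q0 - R)"
  shows "(measure (guided Q0 W) R > measure Q0 R \<longleftrightarrow> guidance_gain Q0 W R > 0)
    \<and> (measure (guided Q0 W) R < measure Q0 R \<longleftrightarrow> guidance_gain Q0 W R < 0)
    \<and> (\<forall>\<gamma>\<ge>0.
          (guidance_gain Q0 W R \<ge> \<gamma> \<longrightarrow>
             measure (guided Q0 W) R \<ge> sigmoid (base_log_odds Q0 R + \<gamma>))
        \<and> (guidance_gain Q0 W R \<le> - \<gamma> \<longrightarrow>
             measure (guided Q0 W) R \<le> sigmoid (base_log_odds Q0 R - \<gamma>)))"
proof -
  have "measure (guided Q0 W) R = sigmoid (base_log_odds Q0 R + guidance_gain Q0 W R)"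
    using assms by (intro guided_prob_eq_sigmoid) auto
  moreover have "measure Q0 R = sigmoid (base_log_odds Q0 R)"
    using assms by (intro base_prob_eq_sigmoid) auto
  ultimately show ?thesis
    by simp
qed

end
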